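(* Let $g(t)=\frac1{\sqrt{2\pi}}e^{-t^2/2}$ be the Gaussian window. Let $x\in\mathcal{E}_{\varepsilon_1,\varepsilon_3}$ for some $\varepsilon_1,\varepsilon_3>0$. Let $\rho>0$ and $\triangle>0$ be such that $$|\phi_k'(t)-\phi_\ell'(t)|+\rho\,|\phi_k''(t)-\phi_\ell''(t)|\ge 2\triangle\qquad\text{for all } t\in\mathbb{R},\ 0\le k,\ell\le K,\ k\ne\ell .$$ Fix $t\in\mathbb{R}$ and suppose that $$2M(t)\big(\Upsilon(t)+\Pi(t)\big)\le \mu(t)\qquad\text{and}\qquad \frac{2\,\mathrm{Res}_\ell(t)}{A_\ell(t)}\le 1-e^{-1/4}\quad\text{for } 0\le\ell\le K .$$ Let $\widetilde\epsilon_1=\widetilde\epsilon_1(t)>0$ satisfy $$M(t)\big(\Upsilon(t)+\Pi(t)\big)\le\widetilde\epsilon_1\le\mu(t)-M(t)\big(\Upsilon(t)+\Pi(t)\big),$$ and let $$\mathcal{G}_t=\{(\eta,\lambda)\in\mathbb{R}^2:\ |\mathcal{Q}_x(t,\eta,\lambda)|>\widetilde\epsilon_1\},$$ $$\mathcal{G}_{t,k}=\{(\eta,\lambda)\in\mathcal{G}_t:\ |\eta-\phi_k'(t)|+\rho\,|\lambda-\phi_k''(t)|<\triangle\},\quad 0\le k\le K .$$ Set $\widehat\eta_0=\widehat\lambda_0=0$ and, for $1\le k\le K$, $(\widehat\eta_k,\widehat\lambda_k)=(\widehat\eta_k(t),\widehat\lambda_k(t))=\mathrm{argmax}_{(\eta,\lambda)\in\mathcal{G}_{t,k}}|\mathcal{Q}_x(t,\eta,\lambda)|$.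 Then for $\ell=1,\dots,K$, $$|\widehat\eta_\ell(t)-\phi_\ell'(t)|\le\frac{1}{\sigma(t)\,\pi\sqrt2}\sqrt{-\ln\Big(1-\frac{2\,\mathrm{Res}_\ell(t)}{A_\ell(t)}\Big)},$$ $$|\widehat\lambda_\ell(t)-\phi_\ell''(t)|\le\frac{1}{\sigma^2(t)\,2\pi\big(1-\frac{2\,\mathrm{Res}_\ell(t)}{A_\ell(t)}\big)^2}\sqrt{1-\Big(1-\frac{2\,\mathrm{Res}_\ell(t)}{A_\ell(t)}\Big)^4},$$ and for $\ell=0,1,\dots,K$, $$\big|\mathcal{Q}_x(t,\widehat\eta_\ell,\widehat\lambda_\ell)-x_\ell(t)\big|\le\mathrm{Res}_\ell(t)+2e^{1/8}I_1\sqrt{\mathrm{Res}_\ell(t)A_\ell(t)}+\frac{I_2A_\ell(t)}{2\big(1-\frac{2\,\mathrm{Res}_\ell(t)}{A_\ell(t)}\big)^2}\sqrt{1-\Big(1-\frac{2\,\mathrm{Res}_\ell(t)}{A_\ell(t)}\Big)^4}.$$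
   Context: **Signals.** Let $K\ge1$ be an integer and $\varepsilon_1,\varepsilon_3>0$. $\mathcal{E}_{\varepsilon_1,\varepsilon_3}$ is the set of signals $x(t)=\sum_{k=0}^K x_k(t)$, $x_k(t)=A_k(t)e^{i2\pi\phi_k(t)}$, $t\in\mathbb{R}$, where $\phi_0\equiv0$ (so $x_0=A_0$ is the trend), and: - for $0\le k\le K$: $A_k\in L_\infty(\mathbb{R})$, $A_k(t)>0$, and $|A_k(t+\tau)-A_k(t)|\le\varepsilon_1|\tau|A_k(t)$ for all $t,\tau\in\mathbb{R}$; - for $1\le k\le K$: $\phi_k\in C^3(\mathbb{R})$ is real-valued, $\inf_{t}\phi_k'(t)>0$, $\sup_t\phi_k'(t)<\infty$, and $|\phi_k'''(t)|\le\varepsilon_3$ for all $t\in\mathbb{R}$. Put $\mu(t)=\min_{0\le k\le K}A_k(t)$ and $M(t)=\sum_{k=0}^K A_k(t)$. **Transform.** $\sigma(t)>0$ is a positive function on $\mathbb{R}$; write $\sigma=\sigma(t)$. With $g$ the Gaussian window of the claim, the adaptive chirplet transform of $x$ is $$\mathcal{Q}_x(t,\eta,\lambda)=\int_{\mathbb{R}}x(t+\tau)\,\frac1{\sigma(t)}g\Big(\frac{\tau}{\sigma(t)}\Big)e^{-i2\pi\eta\tau-i\pi\lambda\tau^2}\,d\tau .$$ Also let $$\breve g(\eta,\lambda)=\int_{\mathbb{R}}g(\tau)e^{-i2\pi\eta\tau-i\pi\lambda\tau^2}\,d\tau,\qquad I_n=\int_{\mathbb{R}}|g(t)t^n|\,dt,$$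 $$\Pi(t)=\varepsilon_1I_1\sigma(t)+\frac{\pi}{3}\varepsilon_3I_3\sigma^3(t).$$ **Bounding functions.** For the given $\rho,\triangle>0$, let $Z_k=\{(t,\eta,\lambda)\in\mathbb{R}^3:\ |\eta-\phi_k'(t)|+\rho|\lambda-\phi_k''(t)|<\triangle\}$, $0\le k\le K$. $\Upsilon(t)$ and $\Upsilon_{\ell,k}(t)$ ($0\le\ell,k\le K$, $k\ne\ell$) are any functions with $\Upsilon(t)\ge\Upsilon_{\ell,k}(t)$ for all $k\neq\ell$ such that, for every $t$, $$\big|\breve g\big(\sigma(\eta-\phi_k'(t)),\sigma^2(\lambda-\phi_k''(t))\big)\big|\le\Upsilon(t)\quad\text{for all }0\le k\le K\text{ and all }(\eta,\lambda)\text{ with }(t,\eta,\lambda)\notin\textstyle\bigcup_{j=0}^KZ_j,$$ $$\big|\breve g\big(\sigma(\eta-\phi_k'(t)),\sigma^2(\lambda-\phi_k''(t))\big)\big|\le\Upsilon_{\ell,k}(t)\quad\text{for all }k\ne\ell\text{ and all }(\eta,\lambda)\text{ with }(t,\eta,\lambda)\in Z_\ell .$$ Finally, $$\mathrm{Res}_\ell(t)=M(t)\Pi(t)+\sum_{0\le k\le K,\ k\ne\ell}A_k(t)\Upsilon_{\ell,k}(t).$$ If the argmax is not unique, $(\widehat\eta_k,\widehat\lambda_k)$ denotes any maximizer. *)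

theory Defs
  imports "HOL-Probability.Distributions"
begin

section \<open>Signals\<close>

definition L_infinity :: "(real \<Rightarrow> real) \<Rightarrow> bool" where
  "L_infinity f \<longleftrightarrow>
     f \<in> borel_measurable lebesgue \<and> (\<exists>C. AE t in lebesgue. \<bar>f t\<bar> \<le> C)"

definition C3 :: "(real \<Rightarrow> real) \<Rightarrow> bool" where
  "C3 f \<longleftrightarrow>
     (\<forall>n<3. \<forall>t. ((deriv ^^ n) f) differentiable (at t)) \<and> continuous_on UNIV ((deriv ^^ 3) f)"

definition mode :: "(nat \<Rightarrow> real \<Rightarrow> real) \<Rightarrow> (nat \<Rightarrow> real \<Rightarrow> real) \<Rightarrow> nat \<Rightarrow> real \<Rightarrow> complex" where
  "mode A \<phi> k t = complex_of_real (A k t) * exp (\<i> * complex_of_real (2 * pi * \<phi> k t))"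

text \<open>
  A signal belongs to the class with parameters \<open>\<epsilon>1\<close>, \<open>\<epsilon>3\<close> iff it has some representation
  in the sense below. The predicate keeps the amplitudes and phases explicit, because the
  error bounds refer to them. The infimum and supremum of the derivative of a phase are taken
  in the extended reals, so that an unbounded derivative is not assigned a junk value.
\<close>

definition signal_representation ::
    "nat \<Rightarrow> real \<Rightarrow> real \<Rightarrow> (nat \<Rightarrow> real \<Rightarrow> real) \<Rightarrow> (nat \<Rightarrow> real \<Rightarrow> real) \<Rightarrow> (real \<Rightarrow> complex) \<Rightarrow> bool"
  where
  "signal_representation K \<epsilon>1 \<epsilon>3 A \<phi> x \<longleftrightarrow>
     (\<forall>k\<le>K. L_infinity (A k) \<and> (\<forall>t. 0 < A k t) \<and>
        (\<forall>t \<tau>. \<bar>A k (t + \<tau>) - A k t\<bar> \<le> \<epsilon>1 * \<bar>\<tau>\<bar> * A k t)) \<and>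
     \<phi> 0 = (\<lambda>_. 0) \<and>
     (\<forall>k\<in>{1..K}. C3 (\<phi> k) \<and>
        0 < (INF t. ereal (deriv (\<phi> k) t)) \<and>
        (SUP t. ereal (deriv (\<phi> k) t)) < \<infinity> \<and>
        (\<forall>t. \<bar>(deriv ^^ 3) (\<phi> k) t\<bar> \<le> \<epsilon>3)) \<and>
     x = (\<lambda>t. \<Sum>k\<le>K. mode A \<phi> k t)"

definition signal_class :: "nat \<Rightarrow> real \<Rightarrow> real \<Rightarrow> (real \<Rightarrow> complex) set" where
  "signal_class K \<epsilon>1 \<epsilon>3 = {x. \<exists>A \<phi>. signal_representation K \<epsilon>1 \<epsilon>3 A \<phi> x}"

definition min_amp :: "nat \<Rightarrow> (nat \<Rightarrow> real \<Rightarrow> real) \<Rightarrow> real \<Rightarrow> real" where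
  "min_amp K A t = (MIN k\<in>{..K}. A k t)"

definition sum_amp :: "nat \<Rightarrow> (nat \<Rightarrow> real \<Rightarrow> real) \<Rightarrow> real \<Rightarrow> real" where
  "sum_amp K A t = (\<Sum>k\<le>K. A k t)"


section \<open>The adaptive chirplet transform with Gaussian window\<close>

definition gauss_window :: "real \<Rightarrow> real" where
  "gauss_window t = 1 / sqrt (2 * pi) * exp (- t\<^sup>2 / 2)"

lemma gauss_window_eq_std_normal_density: "gauss_window = std_normal_density"
  by (rule ext) (simp add: gauss_window_def std_normal_density_def)

definition chirplet_transform ::
    "(real \<Rightarrow> real) \<Rightarrow> (real \<Rightarrow> complex) \<Rightarrow> real \<Rightarrow> real \<Rightarrow> real \<Rightarrow> complex" where
  "chirplet_transform \<sigma> x t \<eta> lam =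
     (LBINT \<tau>. x (t + \<tau>) * complex_of_real (1 / \<sigma> t * gauss_window (\<tau> / \<sigma> t)) *
        exp (- \<i> * complex_of_real (2 * pi * \<eta> * \<tau>) - \<i> * complex_of_real (pi * lam * \<tau>\<^sup>2)))"

definition window_transform :: "real \<Rightarrow> real \<Rightarrow> complex" where
  "window_transform \<eta> lam =
     (LBINT \<tau>. complex_of_real (gauss_window \<tau>) *
        exp (- \<i> * complex_of_real (2 * pi * \<eta> * \<tau>) - \<i> * complex_of_real (pi * lam * \<tau>\<^sup>2)))"

definition window_moment :: "nat \<Rightarrow> real" where
  "window_moment n = (LBINT t. \<bar>gauss_window t * t ^ n\<bar>)"

definition Pi_err :: "real \<Rightarrow> real \<Rightarrow> (real \<Rightarrow> real) \<Rightarrow> real \<Rightarrow> real" where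
  "Pi_err \<epsilon>1 \<epsilon>3 \<sigma> t =
     \<epsilon>1 * window_moment 1 * \<sigma> t + pi / 3 * \<epsilon>3 * window_moment 3 * (\<sigma> t) ^ 3"


section \<open>Zones and bounding functions\<close>

definition zone ::
    "(nat \<Rightarrow> real \<Rightarrow> real) \<Rightarrow> real \<Rightarrow> real \<Rightarrow> nat \<Rightarrow> (real \<times> real \<times> real) set" where
  "zone \<phi> \<rho> \<delta> k =
     {(t, \<eta>, lam). \<bar>\<eta> - deriv (\<phi> k) t\<bar> + \<rho> * \<bar>lam - (deriv ^^ 2) (\<phi> k) t\<bar> < \<delta>}"

definition bounding_functions ::
    "nat \<Rightarrow> (nat \<Rightarrow> real \<Rightarrow> real) \<Rightarrow> (real \<Rightarrow> real) \<Rightarrow> real \<Rightarrow> real \<Rightarrow>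
     (real \<Rightarrow> real) \<Rightarrow> (nat \<Rightarrow> nat \<Rightarrow> real \<Rightarrow> real) \<Rightarrow> bool" where
  "bounding_functions K \<phi> \<sigma> \<rho> \<delta> Ups Ups2 \<longleftrightarrow>
     (\<forall>t. \<forall>l\<le>K. \<forall>k\<le>K. k \<noteq> l \<longrightarrow> Ups2 l k t \<le> Ups t) \<and>
     (\<forall>t. \<forall>k\<le>K. \<forall>\<eta> lam. (t, \<eta>, lam) \<notin> (\<Union>j\<le>K. zone \<phi> \<rho> \<delta> j) \<longrightarrow>
        cmod (window_transform (\<sigma> t * (\<eta> - deriv (\<phi> k) t))
                               ((\<sigma> t)\<^sup>2 * (lam - (deriv ^^ 2) (\<phi> k) t))) \<le> Ups t) \<and>
     (\<forall>t. \<forall>l\<le>K. \<forall>k\<le>K. k \<noteq> l \<longrightarrow> (\<forall>\<eta> lam. (t, \<eta>, lam) \<in> zone \<phi> \<rho> \<delta> l \<longrightarrow>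
        cmod (window_transform (\<sigma> t * (\<eta> - deriv (\<phi> k) t))
                               ((\<sigma> t)\<^sup>2 * (lam - (deriv ^^ 2) (\<phi> k) t))) \<le> Ups2 l k t))"

definition residual ::
    "nat \<Rightarrow> real \<Rightarrow> real \<Rightarrow> (nat \<Rightarrow> real \<Rightarrow> real) \<Rightarrow> (real \<Rightarrow> real) \<Rightarrow>
     (nat \<Rightarrow> nat \<Rightarrow> real \<Rightarrow> real) \<Rightarrow> nat \<Rightarrow> real \<Rightarrow> real" where
  "residual K \<epsilon>1 \<epsilon>3 A \<sigma> Ups2 l t =
     sum_amp K A t * Pi_err \<epsilon>1 \<epsilon>3 \<sigma> t + (\<Sum>k\<in>{..K} - {l}. A k t * Ups2 l k t)"

definition super_level :: "(real \<Rightarrow> real) \<Rightarrow> (real \<Rightarrow> complex) \<Rightarrow> real \<Rightarrow> real \<Rightarrow> (real \<times> real) set" where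
  "super_level \<sigma> x e t = {(\<eta>, lam). cmod (chirplet_transform \<sigma> x t \<eta> lam) > e}"

definition super_level_component ::
    "(real \<Rightarrow> real) \<Rightarrow> (real \<Rightarrow> complex) \<Rightarrow> real \<Rightarrow> (nat \<Rightarrow> real \<Rightarrow> real) \<Rightarrow> real \<Rightarrow> real \<Rightarrow>
     real \<Rightarrow> nat \<Rightarrow> (real \<times> real) set" where
  "super_level_component \<sigma> x e \<phi> \<rho> \<delta> t k =
     {(\<eta>, lam) \<in> super_level \<sigma> x e t.
        \<bar>\<eta> - deriv (\<phi> k) t\<bar> + \<rho> * \<bar>lam - (deriv ^^ 2) (\<phi> k) t\<bar> < \<delta>}"

end

theory Submission
  imports Defs "HOL-Probability.Characteristic_Functions"
begin

text \<open>
  Near time \<open>t\<close> every mode looks like a linear chirp, so the chirplet transform of a mode is its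
  value at \<open>t\<close> times the window transform, evaluated at the rescaled distance of \<open>(\<eta>, lam)\<close> from the
  instantaneous frequency and chirp rate of the mode. Freezing the amplitude and replacing the phase by its
  quadratic Taylor polynomial costs at most \<open>A k t * Pi_err\<close>
  (\<open>chirplet_transform_mode_bound\<close>). In the zone of mode \<open>l\<close> the other modes are damped by
  the bounding functions, so there the transform equals \<open>mode A \<phi> l t\<close> times a single
  window transform up to an error \<open>residual l\<close> (\<open>chirplet_transform_in_zone\<close>).
  
  The centre of the zone lies above the threshold \<open>\<epsilon>t\<close> (\<open>residual_less\<close>), hence the value at
  the maximizer is at least the value at the centre. Two applications of the approximation
  turn this into \<open>q \<le> cmod (window_transform u v)\<close> with \<open>q = 1 - 2 * residual l / A l t\<close>, where
  \<open>u\<close> and \<open>v\<close> are the rescaled frequency and chirp rate errors.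
  
  The modulus of the window transform of a Gaussian is explicit (\<open>norm_window_transform_squared\<close>):
  with \<open>w = 1 + (2 \<pi> v)\<^sup>2\<close> it is \<open>w powr (-1/4) * exp (- 2 \<pi>\<^sup>2 u\<^sup>2 / w)\<close>. The factor in front alone
  bounds \<open>v\<close>. For \<open>u\<close> one gets \<open>2 \<pi>\<^sup>2 u\<^sup>2 \<le> w * (- ln q) - w * ln w / 4\<close>. The right-hand side is largest at
  \<open>w = 1\<close> as long as \<open>- ln q \<le> 1/4\<close>, and this is where the constant \<open>exp (-1/4)\<close> in the
  hypothesis comes from.
  
  Finally the window transform is Lipschitz at the origin with constants given by the
  moments of the window (\<open>window_transform_near_one\<close>), so the errors \<open>u\<close> and \<open>v\<close> also control the
  distance of the transform at the maximizer from the mode itself.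
\<close>

section \<open>The Gaussian integral with a linear phase\<close>

text \<open>
  This is the characteristic function of the standard normal distribution after the
  substitution \<open>r \<mapsto> r / sqrt (2 * \<alpha>)\<close>.
\<close>

lemma gaussian_fourier_transform:
  fixes \<alpha> \<beta> :: real
  assumes "\<alpha> > 0"
  shows "(LBINT r. complex_of_real (exp (- \<alpha> * r\<^sup>2)) * iexp (\<beta> * r))
           = complex_of_real (sqrt (pi / \<alpha>) * exp (- \<beta>\<^sup>2 / (4 * \<alpha>)))"
proof -
  define s where "s = 1 / sqrt (2 * \<alpha>)"
  have s: "s > 0" and s2: "s\<^sup>2 = 1 / (2 * \<alpha>)"
    using assms by (auto simp: s_def power_divide)
  have sq: "s * sqrt (2 * pi) = sqrt (pi / \<alpha>)"
    using assms by (simp add: s_def real_sqrt_mult real_sqrt_divide)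
  have std: "(LBINT r. std_normal_density r *\<^sub>R iexp (u * r)) = exp (- u\<^sup>2 / 2)" for u
    using fun_cong[OF char_std_normal_distribution, of u]
    unfolding char_def by (subst (asm) integral_density) (auto simp: normal_density_nonneg)
  have "(LBINT r. complex_of_real (exp (- \<alpha> * r\<^sup>2)) * iexp (\<beta> * r))
      = s *\<^sub>R (LBINT r. complex_of_real (exp (- \<alpha> * (s * r)\<^sup>2)) * iexp (\<beta> * (s * r)))"
    using s by (subst lborel_integral_real_affine[where c = s and t = 0]) auto
  also have "(\<lambda>r. complex_of_real (exp (- \<alpha> * (s * r)\<^sup>2)) * iexp (\<beta> * (s * r)))
      = (\<lambda>r. complex_of_real (sqrt (2 * pi)) * (std_normal_density r *\<^sub>R iexp (\<beta> * s * r)))"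
    using assms by (intro ext)
      (simp add: power_mult_distrib s2 std_normal_density_def scaleR_conv_of_real mult.assoc)
  also have "s *\<^sub>R (LBINT r. complex_of_real (sqrt (2 * pi)) * (std_normal_density r *\<^sub>R iexp (\<beta> * s * r)))
      = complex_of_real (s * sqrt (2 * pi)) * complex_of_real (exp (- (\<beta> * s)\<^sup>2 / 2))"
    by (simp only: integral_mult_right_zero std) (simp add: scaleR_conv_of_real)
  also have "- (\<beta> * s)\<^sup>2 / 2 = - \<beta>\<^sup>2 / (4 * \<alpha>)"
    by (simp add: power_mult_distrib s2)
  finally show ?thesis
    by (simp add: sq)
qed

section \<open>The Gaussian window and its moments\<close>

lemma chirp_eq_iexp:
  "exp (- \<i> * complex_of_real a - \<i> * complex_of_real b) = iexp (- (a + b))"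
  by (simp add: algebra_simps)

lemma iexp_mult_cnj_iexp: "iexp a * cnj (iexp b) = iexp (a - b)"
  by (simp add: exp_cnj right_diff_distrib flip: exp_add)

lemma gauss_window_nonneg [simp]: "0 \<le> gauss_window \<tau>"
  by (simp add: gauss_window_def)

lemma gauss_window_measurable [measurable]: "gauss_window \<in> borel_measurable borel"
  by (simp add: gauss_window_eq_std_normal_density)

lemma integrable_gauss_window_moment: "integrable lborel (\<lambda>\<tau>. gauss_window \<tau> * \<bar>\<tau>\<bar> ^ n)"
  unfolding gauss_window_eq_std_normal_density by (rule integrable_std_normal_moment_abs)

lemma window_moment_eq: "window_moment n = (LBINT \<tau>. gauss_window \<tau> * \<bar>\<tau>\<bar> ^ n)"
  by (simp add: window_moment_def abs_mult power_abs)

lemma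
  fixes a b :: real
  shows integrable_gauss_window_moment_sum:
      "integrable lborel (\<lambda>\<tau>. a * (gauss_window \<tau> * \<bar>\<tau>\<bar> ^ m) + b * (gauss_window \<tau> * \<bar>\<tau>\<bar> ^ n))"
    and integral_gauss_window_moment_sum:
      "(LBINT \<tau>. a * (gauss_window \<tau> * \<bar>\<tau>\<bar> ^ m) + b * (gauss_window \<tau> * \<bar>\<tau>\<bar> ^ n))
         = a * window_moment m + b * window_moment n"
proof -
  have *: "integrable lborel (\<lambda>\<tau>. c * (gauss_window \<tau> * \<bar>\<tau>\<bar> ^ k))" for c :: real and k
    by (intro integrable_mult_right integrable_gauss_window_moment)
  show "integrable lborel (\<lambda>\<tau>. a * (gauss_window \<tau> * \<bar>\<tau>\<bar> ^ m) + b * (gauss_window \<tau> * \<bar>\<tau>\<bar> ^ n))"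
    by (intro Bochner_Integration.integrable_add *)
  show "(LBINT \<tau>. a * (gauss_window \<tau> * \<bar>\<tau>\<bar> ^ m) + b * (gauss_window \<tau> * \<bar>\<tau>\<bar> ^ n))
         = a * window_moment m + b * window_moment n"
    unfolding Bochner_Integration.integral_add[OF * *] integral_mult_right_zero window_moment_eq ..
qed

lemma integrable_gauss_window: "integrable lborel gauss_window"
  using integrable_gauss_window_moment[of 0] by simp

lemma integral_gauss_window: "(LBINT \<tau>. gauss_window \<tau>) = 1"
  unfolding gauss_window_eq_std_normal_density by simp

lemma window_moment_nonneg: "0 \<le> window_moment n"
  unfolding window_moment_def by (rule integral_nonneg_AE) simp

lemma integrable_gauss_window_bounded:
  assumes [measurable]: "f \<in> borel_measurable borel"
    and f: "\<And>\<tau>. cmod (f \<tau>) \<le> 1"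
  shows "integrable lborel (\<lambda>\<tau>. complex_of_real (gauss_window \<tau>) * f \<tau>)"
  by (rule Bochner_Integration.integrable_bound[OF integrable_gauss_window])
    (auto simp: norm_mult intro!: mult_left_le f)

section \<open>The modulus of the window transform\<close>

lemma window_transform_eq:
  "window_transform \<eta> lam
     = (LBINT \<tau>. complex_of_real (gauss_window \<tau>) * iexp (- (2 * pi * \<eta> * \<tau> + pi * lam * \<tau>\<^sup>2)))"
  unfolding window_transform_def chirp_eq_iexp ..

text \<open>
  Multiplying the transform by its conjugate and substituting \<open>s + p\<close> for the second variable
  gives the integral over \<open>p\<close> of the autocorrelation of the chirped window at lag \<open>p\<close>. In the
  product of the chirped window with its shift the quadratic phase cancels, apart from a term
  linear in the position. Both integrals are therefore Gaussian with a linear phase, and no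
  Gaussian integral with a complex variance is needed.
\<close>

lemma norm_window_transform_squared:
  "(cmod (window_transform \<eta> lam))\<^sup>2
     = exp (- (4 * pi\<^sup>2 * \<eta>\<^sup>2 / (1 + (2 * pi * lam)\<^sup>2))) / sqrt (1 + (2 * pi * lam)\<^sup>2)"
proof -
  define w where "w = 1 + (2 * pi * lam)\<^sup>2"
  define G where
    "G \<tau> = complex_of_real (gauss_window \<tau>) * iexp (- (2 * pi * \<eta> * \<tau> + pi * lam * \<tau>\<^sup>2))" for \<tau>
  have [measurable]: "G \<in> borel_measurable borel"
    unfolding G_def by measurable
  have [measurable]: "cnj \<in> borel_measurable borel"
    by (intro borel_measurable_continuous_onI continuous_intros)
  have normG: "cmod (G \<tau>) = gauss_window \<tau>" for \<tau>
    by (simp add: G_def norm_mult)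
  have intG: "integrable lborel G"
    unfolding G_def by (rule integrable_gauss_window_bounded) auto
  have shift: "integrable lborel (\<lambda>p. G (s + p))" for s
    using lborel_integrable_real_affine[OF intG, of 1 s] by simp
  have shiftI: "(LBINT p. G (s + p)) = window_transform \<eta> lam" for s
    using lborel_integral_real_affine[of 1 G s]
    by (simp add: window_transform_eq G_def[abs_def])
  have inner: "(LBINT p. norm (G (s + p) * cnj (G s))) = gauss_window s" for s
    using lborel_integral_real_affine[of 1 gauss_window s]
    by (simp add: norm_mult normG integral_gauss_window)
  have prod_int: "integrable (lborel \<Otimes>\<^sub>M lborel) (\<lambda>(s, p). G (s + p) * cnj (G s))"
  proof (rule lborel_pair.Fubini_integrable)
    show "integrable lborel (\<lambda>s. LBINT p. norm (case (s, p) of (s, p) \<Rightarrow> G (s + p) * cnj (G s)))"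
      by (simp only: prod.case inner integrable_gauss_window)
    show "AE s in lborel. integrable lborel (\<lambda>p. case (s, p) of (s, p) \<Rightarrow> G (s + p) * cnj (G s))"
      using shift by simp
  qed measurable
  have w: "w > 0" by (simp add: w_def add_pos_nonneg)
  \<comment> \<open>With the midpoint \<open>r = s + p / 2\<close> as variable, the product of the two windows separates into a function of \<open>r\<close> and a function of \<open>p\<close>.\<close>
  have correlation: "(LBINT s. G (s + p) * cnj (G s))
      = complex_of_real (1 / (2 * sqrt pi)) *
          (complex_of_real (exp (- (w / 4) * p\<^sup>2)) * iexp (- (2 * pi * \<eta>) * p))" for p
  proof -
    have "(LBINT s. G (s + p) * cnj (G s)) = (LBINT r. G (- p / 2 + r + p) * cnj (G (- p / 2 + r)))"
      by (subst lborel_integral_real_affine[where c = 1 and t = "- p / 2"]) simp_all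
    also have "(\<lambda>r. G (- p / 2 + r + p) * cnj (G (- p / 2 + r)))
        = (\<lambda>r. complex_of_real (1 / (2 * pi) * exp (- p\<^sup>2 / 4)) * iexp (- (2 * pi * \<eta>) * p) *
              (complex_of_real (exp (- 1 * r\<^sup>2)) * iexp (- (2 * pi * lam * p) * r)))"
    proof (rule ext)
      fix r
      let ?a = "- p / 2 + r + p" and ?b = "- p / 2 + r"
      have win: "gauss_window ?a * gauss_window ?b
          = 1 / (2 * pi) * exp (- p\<^sup>2 / 4) * exp (- 1 * r\<^sup>2)"
      proof -
        have "gauss_window ?a * gauss_window ?b = 1 / (2 * pi) * (exp (- ?a\<^sup>2 / 2) * exp (- ?b\<^sup>2 / 2))"
          by (simp add: gauss_window_def)
        also have "exp (- ?a\<^sup>2 / 2) * exp (- ?b\<^sup>2 / 2) = exp (- p\<^sup>2 / 4) * exp (- 1 * r\<^sup>2)"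
          unfolding exp_add[symmetric] by (simp add: power2_eq_square field_simps)
        finally show ?thesis by simp
      qed
      have phase: "iexp (- (2 * pi * \<eta> * ?a + pi * lam * ?a\<^sup>2)) * cnj (iexp (- (2 * pi * \<eta> * ?b + pi * lam * ?b\<^sup>2)))
          = iexp (- (2 * pi * \<eta>) * p) * iexp (- (2 * pi * lam * p) * r)"
      proof -
        have "iexp (- (2 * pi * \<eta> * ?a + pi * lam * ?a\<^sup>2)) * cnj (iexp (- (2 * pi * \<eta> * ?b + pi * lam * ?b\<^sup>2)))
          = iexp (- (2 * pi * \<eta> * ?a + pi * lam * ?a\<^sup>2) - - (2 * pi * \<eta> * ?b + pi * lam * ?b\<^sup>2))"
          by (rule iexp_mult_cnj_iexp)
        also have "- (2 * pi * \<eta> * ?a + pi * lam * ?a\<^sup>2) - - (2 * pi * \<eta> * ?b + pi * lam * ?b\<^sup>2)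
          = - (2 * pi * \<eta>) * p + - (2 * pi * lam * p) * r"
          by (simp add: power2_eq_square algebra_simps)
        also have "iexp (- (2 * pi * \<eta>) * p + - (2 * pi * lam * p) * r)
           = iexp (- (2 * pi * \<eta>) * p) * iexp (- (2 * pi * lam * p) * r)"
          by (simp only: of_real_add distrib_left exp_add)
        finally show ?thesis .
      qed
      have "G ?a * cnj (G ?b) = complex_of_real (gauss_window ?a * gauss_window ?b) *
         (iexp (- (2 * pi * \<eta> * ?a + pi * lam * ?a\<^sup>2)) * cnj (iexp (- (2 * pi * \<eta> * ?b + pi * lam * ?b\<^sup>2))))"
        unfolding G_def by (simp only: complex_cnj_mult complex_cnj_complex_of_real of_real_mult mult_ac)
      then show "G ?a * cnj (G ?b) =
          complex_of_real (1 / (2 * pi) * exp (- p\<^sup>2 / 4)) * iexp (- (2 * pi * \<eta>) * p) *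
              (complex_of_real (exp (- 1 * r\<^sup>2)) * iexp (- (2 * pi * lam * p) * r))"
        unfolding win phase by (simp only: of_real_mult mult_ac)
    qed
    also have "(LBINT r. complex_of_real (1 / (2 * pi) * exp (- p\<^sup>2 / 4)) * iexp (- (2 * pi * \<eta>) * p) *
              (complex_of_real (exp (- 1 * r\<^sup>2)) * iexp (- (2 * pi * lam * p) * r)))
        = complex_of_real (1 / (2 * pi) * exp (- p\<^sup>2 / 4)) * iexp (- (2 * pi * \<eta>) * p) *
            complex_of_real (sqrt (pi / 1) * exp (- (- (2 * pi * lam * p))\<^sup>2 / (4 * 1)))"
      by (simp only: integral_mult_right_zero gaussian_fourier_transform zero_less_one)
    also have "\<dots> = complex_of_real (1 / (2 * pi) * sqrt pi * (exp (- p\<^sup>2 / 4) * exp (- (- (2 * pi * lam * p))\<^sup>2 / (4 * 1))))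
              * iexp (- (2 * pi * \<eta>) * p)"
      by simp
    also have "exp (- p\<^sup>2 / 4) * exp (- (- (2 * pi * lam * p))\<^sup>2 / (4 * 1)) = exp (- (w / 4) * p\<^sup>2)"
      unfolding exp_add[symmetric] w_def by (simp add: power2_eq_square field_simps)
    also have "1 / (2 * pi) * sqrt pi = 1 / (2 * sqrt pi)"
      by (simp add: field_simps)
    finally show ?thesis by simp
  qed
  have "complex_of_real ((cmod (window_transform \<eta> lam))\<^sup>2)
      = window_transform \<eta> lam * cnj (window_transform \<eta> lam)"
    by (rule complex_norm_square)
  also have "cnj (window_transform \<eta> lam) = (LBINT s. cnj (G s))"
    unfolding window_transform_eq G_def by (rule Bochner_Integration.integral_cnj[symmetric])
  also have "window_transform \<eta> lam * (LBINT s. cnj (G s))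
      = (LBINT s. LBINT p. G (s + p) * cnj (G s))"
    by (simp add: shiftI)
  also have "\<dots> = (LBINT p. LBINT s. G (s + p) * cnj (G s))"
    using lborel_pair.Fubini_integral[OF prod_int] by simp
  also have "\<dots> = complex_of_real (1 / (2 * sqrt pi)) *
      complex_of_real (sqrt (pi / (w / 4)) * exp (- (- (2 * pi * \<eta>))\<^sup>2 / (4 * (w / 4))))"
    using w by (simp only: correlation integral_mult_right_zero gaussian_fourier_transform
      zero_less_divide_iff zero_less_numeral simp_thms)
  also have "\<dots> = complex_of_real (exp (- (4 * pi\<^sup>2 * \<eta>\<^sup>2 / w)) / sqrt (w))"
    using w by (simp add: real_sqrt_divide real_sqrt_mult power_mult_distrib)
  finally show ?thesis
    unfolding of_real_eq_iff w_def .
qed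

lemma norm_window_transform_pos: "0 < cmod (window_transform \<eta> lam)"
proof -
  have "0 < 1 + (2 * pi * lam)\<^sup>2"
    by (simp add: add_pos_nonneg)
  then have "0 < (cmod (window_transform \<eta> lam))\<^sup>2"
    unfolding norm_window_transform_squared by simp
  then show ?thesis by simp
qed

section \<open>Offsets at which the window transform is large\<close>

text \<open>
  The frequency enters the modulus only through a factor at most one, so
  \<open>q ^ 4 * (1 + (2 * pi * lam)\<^sup>2) \<le> 1\<close>, and this is solved for \<open>lam\<close>.
\<close>

lemma chirp_rate_le_of_window_transform_ge:
  assumes q: "0 < q" "q \<le> cmod (window_transform \<eta> lam)"
  shows "\<bar>lam\<bar> \<le> 1 / (2 * pi * q\<^sup>2) * sqrt (1 - q ^ 4)"
proof -
  define w where "w = 1 + (2 * pi * lam)\<^sup>2"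
  have w: "w \<ge> 1" by (simp add: w_def)
  have "q\<^sup>2 \<le> exp (- (4 * pi\<^sup>2 * \<eta>\<^sup>2 / w)) / sqrt w"
    using power_mono[OF q(2), of 2] q(1) by (simp add: norm_window_transform_squared w_def)
  also have "\<dots> \<le> 1 / sqrt w"
    using w by (intro divide_right_mono) auto
  finally have "q\<^sup>2 * sqrt w \<le> 1"
    using w by (simp add: field_simps)
  then have "(q\<^sup>2 * sqrt w)\<^sup>2 \<le> 1"
    using w by (intro power_le_one) auto
  then have "q ^ 4 * w \<le> 1"
    using w by (simp add: power_mult_distrib power_mult[symmetric])
  then have "(2 * pi * q\<^sup>2 * \<bar>lam\<bar>)\<^sup>2 \<le> 1 - q ^ 4"
    by (simp add: w_def power_mult_distrib power_mult[symmetric] algebra_simps)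
  then have "2 * pi * q\<^sup>2 * \<bar>lam\<bar> \<le> sqrt (1 - q ^ 4)"
    by (rule real_le_rsqrt)
  then show ?thesis
    using q by (simp add: field_simps)
qed

text \<open>
  A chirp rate offset widens the modulus in the frequency direction by the factor \<open>w\<close>, but lowers
  its peak. For \<open>q \<ge> exp (- 1 / 4)\<close> the loss outweighs the gain, so that the bound for
  \<open>lam = 0\<close> holds for every \<open>lam\<close>.
\<close>

lemma frequency_le_of_window_transform_ge:
  assumes q: "exp (- 1 / 4) \<le> q" "q \<le> cmod (window_transform \<eta> lam)"
  shows "\<bar>\<eta>\<bar> \<le> 1 / (pi * sqrt 2) * sqrt (- ln q)"
proof -
  define w where "w = 1 + (2 * pi * lam)\<^sup>2"
  have w: "w \<ge> 1" by (simp add: w_def)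
  have q0: "q > 0"
    using q(1) exp_gt_zero less_le_trans by blast
  have lnq: "- ln q \<le> 1 / 4"
    using q(1) q0 ln_ge_iff[of q "- 1 / 4"] by simp
  have "q\<^sup>2 \<le> exp (- (4 * pi\<^sup>2 * \<eta>\<^sup>2 / w)) / sqrt w"
    using power_mono[OF q(2), of 2] q0 by (simp add: norm_window_transform_squared w_def)
  then have "ln (q\<^sup>2) \<le> ln (exp (- (4 * pi\<^sup>2 * \<eta>\<^sup>2 / w)) / sqrt w)"
    using q0 w by (subst ln_le_cancel_iff) auto
  then have "2 * ln q \<le> - (4 * pi\<^sup>2 * \<eta>\<^sup>2 / w) - ln w / 2"
    using q0 w by (simp add: ln_div ln_sqrt ln_realpow)
  then have "2 * pi\<^sup>2 * \<eta>\<^sup>2 / w \<le> - ln q - ln w / 4"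
    by simp
  then have "2 * pi\<^sup>2 * \<eta>\<^sup>2 \<le> w * (- ln q) - w * ln w / 4"
    using w by (simp add: field_simps)
  \<comment> \<open>The derivative of the left-hand side in \<open>w\<close> is \<open>- ln q - (ln w + 1) / 4 \<le> 0\<close>. The proof replaces the derivative by \<open>w * ln w \<ge> w - 1\<close>.\<close>
  also have "w * (- ln q) - w * ln w / 4 \<le> - ln q"
  proof -
    have "- ln w \<le> 1 / w - 1"
      using ln_le_minus_one[of "1 / w"] w by (simp add: ln_div)
    then have "w * (- ln w) \<le> w * (1 / w - 1)"
      using w by (intro mult_left_mono) auto
    then have "w - 1 \<le> w * ln w"
      using w by (simp add: algebra_simps)
    moreover have "(w - 1) * (- ln q) \<le> (w - 1) * (1 / 4)"
      using w lnq by (intro mult_left_mono) auto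
    ultimately show ?thesis
      by (simp add: algebra_simps)
  qed
  finally have "(pi * sqrt 2 * \<bar>\<eta>\<bar>)\<^sup>2 \<le> - ln q"
    by (simp add: power_mult_distrib algebra_simps)
  then have "pi * sqrt 2 * \<bar>\<eta>\<bar> \<le> sqrt (- ln q)"
    by (rule real_le_rsqrt)
  then show ?thesis
    by (simp add: field_simps)
qed

section \<open>The window transform near the origin\<close>

lemma norm_iexp_diff_le: "cmod (iexp a - iexp b) \<le> \<bar>a - b\<bar>"
proof -
  have "iexp a - iexp b = iexp b * (iexp (a - b) - 1)"
    by (simp add: algebra_simps exp_add[symmetric])
  then have "cmod (iexp a - iexp b) = cmod (iexp (a - b) - 1)"
    by (simp add: norm_mult)
  also have "\<dots> \<le> \<bar>a - b\<bar>"
    using iexp_approx1[of "a - b" 0] by simp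
  finally show ?thesis .
qed

lemma window_transform_near_one:
  "cmod (window_transform \<eta> lam - 1)
     \<le> 2 * pi * \<bar>\<eta>\<bar> * window_moment 1 + pi * \<bar>lam\<bar> * window_moment 2"
proof -
  let ?F = "\<lambda>\<tau>. complex_of_real (gauss_window \<tau>) * iexp (- (2 * pi * \<eta> * \<tau> + pi * lam * \<tau>\<^sup>2))"
  let ?B = "\<lambda>\<tau>. 2 * pi * \<bar>\<eta>\<bar> * (gauss_window \<tau> * \<bar>\<tau>\<bar> ^ 1) + pi * \<bar>lam\<bar> * (gauss_window \<tau> * \<bar>\<tau>\<bar> ^ 2)"
  have F: "integrable lborel ?F"
    by (rule integrable_gauss_window_bounded) auto
  have g: "integrable lborel (\<lambda>\<tau>. complex_of_real (gauss_window \<tau>))"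
    using integrable_gauss_window by simp
  have diff: "window_transform \<eta> lam - 1 = (LBINT \<tau>. ?F \<tau> - complex_of_real (gauss_window \<tau>))"
    using F g by (simp add: window_transform_eq integral_gauss_window)
  have bound: "cmod (LBINT \<tau>. ?F \<tau> - complex_of_real (gauss_window \<tau>)) \<le> (LBINT \<tau>. ?B \<tau>)"
  proof (rule Bochner_Integration.integral_norm_bound_integral)
    show "integrable lborel ?B"
      by (rule integrable_gauss_window_moment_sum)
    fix \<tau>
    have "?F \<tau> - complex_of_real (gauss_window \<tau>)
        = complex_of_real (gauss_window \<tau>) * (iexp (- (2 * pi * \<eta> * \<tau> + pi * lam * \<tau>\<^sup>2)) - iexp 0)"
      by (simp only: right_diff_distrib of_real_0 mult_zero_right exp_zero mult_1_right)
    then have "cmod (?F \<tau> - complex_of_real (gauss_window \<tau>))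
        = gauss_window \<tau> * cmod (iexp (- (2 * pi * \<eta> * \<tau> + pi * lam * \<tau>\<^sup>2)) - iexp 0)"
      by (simp only: norm_mult norm_of_real abs_of_nonneg[OF gauss_window_nonneg])
    also have "\<dots> \<le> gauss_window \<tau> * \<bar>- (2 * pi * \<eta> * \<tau> + pi * lam * \<tau>\<^sup>2) - 0\<bar>"
      by (intro mult_left_mono norm_iexp_diff_le) simp
    also have "\<dots> \<le> gauss_window \<tau> * (2 * pi * \<bar>\<eta>\<bar> * \<bar>\<tau>\<bar> + pi * \<bar>lam\<bar> * \<bar>\<tau>\<bar>\<^sup>2)"
      using abs_triangle_ineq[of "2 * pi * \<eta> * \<tau>" "pi * lam * \<tau>\<^sup>2"]
      by (intro mult_left_mono) (simp_all add: abs_mult)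
    finally show "cmod (?F \<tau> - complex_of_real (gauss_window \<tau>)) \<le> ?B \<tau>"
      by (simp add: algebra_simps)
  qed (intro Bochner_Integration.integrable_diff F g)
  have moments: "(LBINT \<tau>. ?B \<tau>) = 2 * pi * \<bar>\<eta>\<bar> * window_moment 1 + pi * \<bar>lam\<bar> * window_moment 2"
    by (rule integral_gauss_window_moment_sum)
  show ?thesis
    using bound unfolding diff moments .
qed

section \<open>Local approximation of a mode by a linear chirp\<close>

lemma Taylor_quadratic_bound:
  assumes f: "C3 f" and bound: "\<And>s. \<bar>(deriv ^^ 3) f s\<bar> \<le> B"
  shows "\<bar>f (t + h) - (f t + deriv f t * h + (deriv ^^ 2) f t * h\<^sup>2 / 2)\<bar> \<le> B / 6 * \<bar>h\<bar> ^ 3"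
proof (cases "h = 0")
  case False
  have D: "DERIV ((deriv ^^ m) f) s :> (deriv ^^ Suc m) f s" if "m < 3" for m s
    using f that by (simp add: C3_def DERIV_deriv_iff_real_differentiable)
  have "\<exists>s. (if t + h < t then t + h < s \<and> s < t else t < s \<and> s < t + h) \<and>
      f (t + h) = (\<Sum>m<3. ((deriv ^^ m) f t / fact m) * (t + h - t) ^ m)
                   + ((deriv ^^ 3) f s / fact 3) * (t + h - t) ^ 3"
    by (rule Taylor[where a = "min t (t + h)" and b = "max t (t + h)"]) (use False D in auto)
  then obtain s where "f (t + h) = (\<Sum>m<3. ((deriv ^^ m) f t / fact m) * (t + h - t) ^ m)
                   + ((deriv ^^ 3) f s / fact 3) * (t + h - t) ^ 3"
    by blast
  then have remainder: "f (t + h) - (f t + deriv f t * h + (deriv ^^ 2) f t * h\<^sup>2 / 2) = (deriv ^^ 3) f s / 6 * h ^ 3"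
    by (simp add: eval_nat_numeral)
  show ?thesis
    unfolding remainder using bound[of s] by (simp add: abs_mult power_abs mult_right_mono)
qed (use bound[of t] in simp)

lemma chirplet_transform_rescale:
  assumes "\<sigma> t > 0"
  shows "chirplet_transform \<sigma> x t \<eta> lam
    = (LBINT s. complex_of_real (gauss_window s) *
         (x (t + \<sigma> t * s) * iexp (- (2 * pi * \<eta> * (\<sigma> t * s) + pi * lam * (\<sigma> t * s)\<^sup>2))))"
proof -
  let ?E = "\<lambda>h. iexp (- (2 * pi * \<eta> * h + pi * lam * h\<^sup>2))"
  have "chirplet_transform \<sigma> x t \<eta> lam = \<sigma> t *\<^sub>R
      (LBINT s. x (t + \<sigma> t * s) * complex_of_real (1 / \<sigma> t * gauss_window s) * ?E (\<sigma> t * s))"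
    unfolding chirplet_transform_def chirp_eq_iexp using assms
    by (subst lborel_integral_real_affine[where c = "\<sigma> t" and t = 0]) simp_all
  also have "\<dots> = (LBINT s. complex_of_real (\<sigma> t) *
      (x (t + \<sigma> t * s) * complex_of_real (1 / \<sigma> t * gauss_window s) * ?E (\<sigma> t * s)))"
    by (simp only: scaleR_conv_of_real integral_mult_right_zero)
  also have "(\<lambda>s. complex_of_real (\<sigma> t) *
      (x (t + \<sigma> t * s) * complex_of_real (1 / \<sigma> t * gauss_window s) * ?E (\<sigma> t * s)))
    = (\<lambda>s. complex_of_real (gauss_window s) * (x (t + \<sigma> t * s) * ?E (\<sigma> t * s)))"
    using assms by (simp add: mult_ac)
  finally show ?thesis .
qed

text \<open>
  The amplitudes are only assumed Lebesgue measurable, whereas the transform integrates over the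
  Borel sets. Continuity closes the gap.
\<close>

lemma continuous_on_amplitude:
  fixes a :: "real \<Rightarrow> real"
  assumes "\<And>s h. \<bar>a (s + h) - a s\<bar> \<le> \<epsilon> * \<bar>h\<bar> * a s"
  shows "continuous_on UNIV a"
proof (rule continuous_at_imp_continuous_on, rule ballI)
  fix s
  have "((\<lambda>h. a (s + h) - a s) \<longlongrightarrow> 0) (at 0)"
  proof (rule Lim_null_comparison)
    show "\<forall>\<^sub>F h in at 0. norm (a (s + h) - a s) \<le> \<epsilon> * \<bar>h\<bar> * a s"
      unfolding real_norm_def by (intro always_eventually allI assms)
    have "((\<lambda>h. \<epsilon> * \<bar>h\<bar> * a s) \<longlongrightarrow> \<epsilon> * \<bar>0\<bar> * a s) (at 0)"
      by (intro tendsto_intros)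
    then show "((\<lambda>h. \<epsilon> * \<bar>h\<bar> * a s) \<longlongrightarrow> 0) (at 0)"
      by simp
  qed
  then show "isCont a s"
    unfolding isCont_iff by (rule LIM_zero_cancel)
qed

lemma norm_mode: "0 < A k s \<Longrightarrow> cmod (mode A \<phi> k s) = A k s"
  by (simp add: mode_def norm_mult)

text \<open>
  The amplitude term contributes \<open>\<epsilon>1 * \<bar>h\<bar>\<close>, and the cubic Taylor remainder \<open>\<epsilon>3 / 6 * \<bar>h\<bar> ^ 3\<close> of the phase,
  multiplied by \<open>2 * pi\<close>, contributes the other term.
\<close>

lemma mode_frozen_chirp_bound:
  assumes pos: "0 < A k t"
    and amp: "\<bar>A k (t + h) - A k t\<bar> \<le> \<epsilon>1 * \<bar>h\<bar> * A k t"
    and C3: "C3 (\<phi> k)" and third: "\<And>s. \<bar>(deriv ^^ 3) (\<phi> k) s\<bar> \<le> \<epsilon>3"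
  shows "cmod (mode A \<phi> k (t + h)
      - mode A \<phi> k t * iexp (2 * pi * (deriv (\<phi> k) t * h + (deriv ^^ 2) (\<phi> k) t * h\<^sup>2 / 2)))
    \<le> A k t * (\<epsilon>1 * \<bar>h\<bar> + pi / 3 * \<epsilon>3 * \<bar>h\<bar> ^ 3)"
proof -
  let ?p = "deriv (\<phi> k) t * h + (deriv ^^ 2) (\<phi> k) t * h\<^sup>2 / 2"
  let ?e = "iexp (2 * pi * \<phi> k (t + h))" and ?e' = "iexp (2 * pi * (\<phi> k t + ?p))"
  have "?e' = iexp (2 * pi * \<phi> k t) * iexp (2 * pi * ?p)"
    by (simp only: distrib_left of_real_add exp_add)
  then have "mode A \<phi> k (t + h) - mode A \<phi> k t * iexp (2 * pi * ?p)
      = complex_of_real (A k (t + h) - A k t) * ?e + complex_of_real (A k t) * (?e - ?e')"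
    unfolding mode_def by (simp only: of_real_diff) (simp add: algebra_simps)
  then have "cmod (mode A \<phi> k (t + h) - mode A \<phi> k t * iexp (2 * pi * ?p))
      \<le> cmod (complex_of_real (A k (t + h) - A k t) * ?e) + cmod (complex_of_real (A k t) * (?e - ?e'))"
    by (simp only: norm_triangle_ineq)
  then have split: "cmod (mode A \<phi> k (t + h) - mode A \<phi> k t * iexp (2 * pi * ?p))
      \<le> \<bar>A k (t + h) - A k t\<bar> + A k t * cmod (?e - ?e')"
    using pos by (simp only: norm_mult norm_of_real norm_exp_i_times mult_1_right abs_of_pos)
  have "cmod (?e - ?e') \<le> \<bar>2 * pi * \<phi> k (t + h) - 2 * pi * (\<phi> k t + ?p)\<bar>"
    by (rule norm_iexp_diff_le)
  also have "\<dots> = 2 * pi * \<bar>\<phi> k (t + h) - (\<phi> k t + ?p)\<bar>"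
    by (simp only: right_diff_distrib[symmetric] abs_mult) simp
  finally have phase: "cmod (?e - ?e') \<le> 2 * pi * \<bar>\<phi> k (t + h) - (\<phi> k t + ?p)\<bar>" .
  have "\<bar>\<phi> k (t + h) - (\<phi> k t + ?p)\<bar> \<le> \<epsilon>3 / 6 * \<bar>h\<bar> ^ 3"
    using Taylor_quadratic_bound[OF C3 third, of t h] by (simp add: add.assoc)
  then have "2 * pi * \<bar>\<phi> k (t + h) - (\<phi> k t + ?p)\<bar> \<le> 2 * pi * (\<epsilon>3 / 6 * \<bar>h\<bar> ^ 3)"
    by (intro mult_left_mono) auto
  with phase have "cmod (?e - ?e') \<le> 2 * pi * (\<epsilon>3 / 6 * \<bar>h\<bar> ^ 3)"
    by (rule order.trans)
  then have "A k t * cmod (?e - ?e') \<le> A k t * (2 * pi * (\<epsilon>3 / 6 * \<bar>h\<bar> ^ 3))"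
    by (rule mult_left_mono) (rule less_imp_le[OF pos])
  with split amp show ?thesis
    by (simp add: algebra_simps)
qed

text \<open>
  The slow variation condition at \<open>t\<close> alone makes the amplitude grow at most linearly, which the
  Gaussian window absorbs.
\<close>

lemma integrable_chirped_mode:
  assumes pos: "\<And>s. 0 < A k s"
    and amp: "\<And>s h. \<bar>A k (s + h) - A k s\<bar> \<le> \<epsilon> * \<bar>h\<bar> * A k s"
    and C3: "C3 (\<phi> k)"
  shows "integrable lborel (\<lambda>s. complex_of_real (gauss_window s) *
           (mode A \<phi> k (t + c * s) * iexp (- (\<alpha> * (c * s) + \<beta> * (c * s)\<^sup>2))))"
proof (rule Bochner_Integration.integrable_bound)
  let ?B = "\<lambda>s. A k t * (gauss_window s * \<bar>s\<bar> ^ 0) + (\<epsilon> * \<bar>c\<bar> * A k t) * (gauss_window s * \<bar>s\<bar> ^ 1)"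
  show "integrable lborel ?B"
    by (rule integrable_gauss_window_moment_sum)
  have [measurable]: "A k \<in> borel_measurable borel"
    using continuous_on_amplitude[OF amp] by (rule borel_measurable_continuous_onI)
  have "\<phi> k differentiable at s" for s
    using C3 by (auto simp: C3_def dest: spec[of _ 0])
  then have [measurable]: "\<phi> k \<in> borel_measurable borel"
    by (intro borel_measurable_continuous_onI continuous_at_imp_continuous_on)
      (simp add: differentiable_imp_continuous_within)
  show "(\<lambda>s. complex_of_real (gauss_window s) *
           (mode A \<phi> k (t + c * s) * iexp (- (\<alpha> * (c * s) + \<beta> * (c * s)\<^sup>2)))) \<in> borel_measurable lborel"
    unfolding mode_def by measurable
  have "A k (t + c * s) \<le> A k t + \<epsilon> * \<bar>c\<bar> * A k t * \<bar>s\<bar>" for s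
    using amp[of t "c * s"] by (simp add: abs_mult mult_ac)
  then have "gauss_window s * A k (t + c * s) \<le> gauss_window s * (A k t + \<epsilon> * \<bar>c\<bar> * A k t * \<bar>s\<bar>)" for s
    by (intro mult_left_mono) auto
  also have "gauss_window s * (A k t + \<epsilon> * \<bar>c\<bar> * A k t * \<bar>s\<bar>) = ?B s" for s
    by (simp add: algebra_simps)
  finally have "gauss_window s * A k (t + c * s) \<le> ?B s" for s .
  then show "AE s in lborel. norm (complex_of_real (gauss_window s) *
           (mode A \<phi> k (t + c * s) * iexp (- (\<alpha> * (c * s) + \<beta> * (c * s)\<^sup>2)))) \<le> norm (?B s)"
    by (intro AE_I2) (simp only: norm_mult norm_of_real norm_mode[where A = A and k = k, OF pos] norm_exp_i_times
      abs_of_nonneg[OF gauss_window_nonneg] mult_1_right real_norm_def, meson abs_ge_self order.trans)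
qed

text \<open>
  The chirp that replaces the mode merges with the kernel of the transform and only shifts its frequency and chirp
  rate, so it produces the window transform exactly. The error of the replacement, weighted by the window,
  integrates to the moments that make up \<open>Pi_err\<close>.
\<close>

lemma chirplet_transform_mode_bound:
  assumes \<sigma>: "\<sigma> t > 0"
    and pos: "\<And>s. 0 < A k s"
    and amp: "\<And>s h. \<bar>A k (s + h) - A k s\<bar> \<le> \<epsilon>1 * \<bar>h\<bar> * A k s"
    and C3: "C3 (\<phi> k)" and third: "\<And>s. \<bar>(deriv ^^ 3) (\<phi> k) s\<bar> \<le> \<epsilon>3"
  shows "cmod (chirplet_transform \<sigma> (mode A \<phi> k) t \<eta> lam
      - mode A \<phi> k t * window_transform (\<sigma> t * (\<eta> - deriv (\<phi> k) t))
                                          ((\<sigma> t)\<^sup>2 * (lam - (deriv ^^ 2) (\<phi> k) t)))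
    \<le> A k t * Pi_err \<epsilon>1 \<epsilon>3 \<sigma> t"
proof -
  let ?c = "\<sigma> t" and ?a = "deriv (\<phi> k) t" and ?b = "(deriv ^^ 2) (\<phi> k) t"
  let ?E = "\<lambda>h. iexp (- (2 * pi * \<eta> * h + pi * lam * h\<^sup>2))"
  let ?P = "\<lambda>h. iexp (2 * pi * (?a * h + ?b * h\<^sup>2 / 2))"
  let ?F = "\<lambda>s. complex_of_real (gauss_window s) * (mode A \<phi> k (t + ?c * s) * ?E (?c * s))"
  let ?H = "\<lambda>s. mode A \<phi> k t * (complex_of_real (gauss_window s) *
      iexp (- (2 * pi * (?c * (\<eta> - ?a)) * s + pi * (?c\<^sup>2 * (lam - ?b)) * s\<^sup>2)))"
  let ?B = "\<lambda>s. (A k t * \<epsilon>1 * ?c) * (gauss_window s * \<bar>s\<bar> ^ 1)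
              + (A k t * (pi / 3) * \<epsilon>3 * ?c ^ 3) * (gauss_window s * \<bar>s\<bar> ^ 3)"
  have F: "integrable lborel ?F"
    by (rule integrable_chirped_mode[where A = A and \<phi> = \<phi> and k = k, OF pos amp C3])
  have H: "integrable lborel ?H"
    by (intro integrable_mult_right integrable_gauss_window_bounded) auto
  have B: "integrable lborel ?B"
    by (rule integrable_gauss_window_moment_sum)
  have diff: "chirplet_transform \<sigma> (mode A \<phi> k) t \<eta> lam
      - mode A \<phi> k t * window_transform (?c * (\<eta> - ?a)) (?c\<^sup>2 * (lam - ?b)) = (LBINT s. ?F s - ?H s)"
    unfolding Bochner_Integration.integral_diff[OF F H] integral_mult_right_zero
      chirplet_transform_rescale[where \<sigma> = \<sigma>, OF \<sigma>] window_transform_eq ..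
  have bound: "cmod (LBINT s. ?F s - ?H s) \<le> (LBINT s. ?B s)"
  proof (rule Bochner_Integration.integral_norm_bound_integral[OF Bochner_Integration.integrable_diff[OF F H] B])
    fix s
    have "iexp (- (2 * pi * (?c * (\<eta> - ?a)) * s + pi * (?c\<^sup>2 * (lam - ?b)) * s\<^sup>2))
        = iexp (2 * pi * (?a * (?c * s) + ?b * (?c * s)\<^sup>2 / 2) + - (2 * pi * \<eta> * (?c * s) + pi * lam * (?c * s)\<^sup>2))"
      by (rule arg_cong[of _ _ iexp]) (simp add: power_mult_distrib algebra_simps)
    also have "\<dots> = ?P (?c * s) * ?E (?c * s)"
      by (simp only: of_real_add distrib_left exp_add)
    finally have "?F s - ?H s
        = complex_of_real (gauss_window s) * ((mode A \<phi> k (t + ?c * s) - mode A \<phi> k t * ?P (?c * s)) * ?E (?c * s))"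
      by (simp only: algebra_simps)
    then have "cmod (?F s - ?H s)
        = gauss_window s * cmod (mode A \<phi> k (t + ?c * s) - mode A \<phi> k t * ?P (?c * s))"
      by (simp only: norm_mult norm_of_real norm_exp_i_times mult_1_right abs_of_nonneg[OF gauss_window_nonneg])
    also have "\<dots> \<le> gauss_window s * (A k t * (\<epsilon>1 * \<bar>?c * s\<bar> + pi / 3 * \<epsilon>3 * \<bar>?c * s\<bar> ^ 3))"
      by (intro mult_left_mono mode_frozen_chirp_bound[where A = A and k = k] pos amp C3 third) simp
    also have "\<dots> = ?B s"
      using \<sigma> by (simp add: abs_mult power_mult_distrib algebra_simps)
    finally show "cmod (?F s - ?H s) \<le> ?B s" .
  qed
  have "(LBINT s. ?B s)
      = (A k t * \<epsilon>1 * ?c) * window_moment 1 + (A k t * (pi / 3) * \<epsilon>3 * ?c ^ 3) * window_moment 3"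
    by (rule integral_gauss_window_moment_sum)
  also have "\<dots> = A k t * Pi_err \<epsilon>1 \<epsilon>3 \<sigma> t"
    by (simp add: Pi_err_def algebra_simps)
  finally have moments: "(LBINT s. ?B s) = A k t * Pi_err \<epsilon>1 \<epsilon>3 \<sigma> t" .
  show ?thesis
    using bound unfolding diff moments .
qed

text \<open>
  The conditions on a phase are imposed only for the oscillating modes. The constant phase of the trend
  satisfies those listed here as well, so all modes can be treated alike.
\<close>

lemma signal_representation_modeD:
  assumes "signal_representation K \<epsilon>1 \<epsilon>3 A \<phi> x" "0 \<le> \<epsilon>3" "k \<le> K"
  shows "0 < A k s" "\<bar>A k (s + h) - A k s\<bar> \<le> \<epsilon>1 * \<bar>h\<bar> * A k s"
    "C3 (\<phi> k)" "\<bar>(deriv ^^ 3) (\<phi> k) s\<bar> \<le> \<epsilon>3"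
proof -
  have deriv0: "(deriv ^^ n) (\<lambda>_. 0) = (\<lambda>_. 0 :: real)" for n
    by (induction n) simp_all
  have "\<phi> 0 = (\<lambda>_. 0)"
    using assms by (simp add: signal_representation_def)
  then have "C3 (\<phi> 0)" "\<bar>(deriv ^^ 3) (\<phi> 0) s\<bar> \<le> \<epsilon>3"
    using assms(2) by (simp_all only: C3_def deriv0) simp_all
  then show "C3 (\<phi> k)" "\<bar>(deriv ^^ 3) (\<phi> k) s\<bar> \<le> \<epsilon>3"
    using assms by (cases "k = 0"; auto simp: signal_representation_def)+
qed (use assms in \<open>auto simp: signal_representation_def\<close>)

lemma chirplet_transform_signal_bound:
  assumes x: "signal_representation K \<epsilon>1 \<epsilon>3 A \<phi> x" and \<epsilon>3: "0 \<le> \<epsilon>3" and \<sigma>: "\<sigma> t > 0"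
  shows "cmod (chirplet_transform \<sigma> x t \<eta> lam
      - (\<Sum>k\<le>K. mode A \<phi> k t * window_transform (\<sigma> t * (\<eta> - deriv (\<phi> k) t))
                                          ((\<sigma> t)\<^sup>2 * (lam - (deriv ^^ 2) (\<phi> k) t))))
    \<le> sum_amp K A t * Pi_err \<epsilon>1 \<epsilon>3 \<sigma> t"
proof -
  note D = signal_representation_modeD[OF x \<epsilon>3]
  let ?W = "\<lambda>k. window_transform (\<sigma> t * (\<eta> - deriv (\<phi> k) t)) ((\<sigma> t)\<^sup>2 * (lam - (deriv ^^ 2) (\<phi> k) t))"
  have "chirplet_transform \<sigma> x t \<eta> lam = (\<Sum>k\<le>K. chirplet_transform \<sigma> (mode A \<phi> k) t \<eta> lam)"
  proof -
    have "x = (\<lambda>t. \<Sum>k\<le>K. mode A \<phi> k t)"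
      using x by (simp add: signal_representation_def)
    then show ?thesis
      unfolding chirplet_transform_rescale[where \<sigma> = \<sigma>, OF \<sigma>]
      by (simp only: sum_distrib_left sum_distrib_right, subst Bochner_Integration.integral_sum)
        (rule integrable_chirped_mode[where \<epsilon> = \<epsilon>1], simp_all only: D atMost_iff)
  qed
  then have "cmod (chirplet_transform \<sigma> x t \<eta> lam - (\<Sum>k\<le>K. mode A \<phi> k t * ?W k))
      = cmod (\<Sum>k\<le>K. chirplet_transform \<sigma> (mode A \<phi> k) t \<eta> lam - mode A \<phi> k t * ?W k)"
    by (simp add: sum_subtractf)
  also have "\<dots> \<le> (\<Sum>k\<le>K. A k t * Pi_err \<epsilon>1 \<epsilon>3 \<sigma> t)"
    by (intro sum_norm_le chirplet_transform_mode_bound \<sigma> D) auto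
  finally show ?thesis
    by (simp add: sum_amp_def sum_distrib_right)
qed

section \<open>Isolating one mode in its zone\<close>

lemma window_transform_0 [simp]: "window_transform 0 0 = 1"
  using window_transform_near_one[of 0 0] by simp

lemma Pi_err_nonneg:
  assumes "0 \<le> \<epsilon>1" "0 \<le> \<epsilon>3" "0 \<le> \<sigma> t"
  shows "0 \<le> Pi_err \<epsilon>1 \<epsilon>3 \<sigma> t"
  using assms by (simp add: Pi_err_def window_moment_nonneg)

lemma center_in_zone: "0 < \<delta> \<Longrightarrow> (t, deriv (\<phi> l) t, (deriv ^^ 2) (\<phi> l) t) \<in> zone \<phi> \<rho> \<delta> l"
  by (simp add: zone_def)

text \<open>
  A bounding function dominates the window transform at the centre of a zone, and the modulus of the Gaussian
  window transform vanishes nowhere.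
\<close>

lemma bounding_functions_pos:
  assumes "bounding_functions K \<phi> \<sigma> \<rho> \<delta> Ups Ups2" "0 < \<delta>" "l \<le> K" "k \<le> K" "k \<noteq> l"
  shows "0 < Ups2 l k t"
proof -
  have "0 < cmod (window_transform (\<sigma> t * (deriv (\<phi> l) t - deriv (\<phi> k) t))
      ((\<sigma> t)\<^sup>2 * ((deriv ^^ 2) (\<phi> l) t - (deriv ^^ 2) (\<phi> k) t)))"
    by (rule norm_window_transform_pos)
  also have "\<dots> \<le> Ups2 l k t"
    using assms center_in_zone[OF assms(2), of t \<phi> l \<rho>] unfolding bounding_functions_def by blast
  finally show ?thesis .
qed

lemma residual_nonneg:
  assumes x: "signal_representation K \<epsilon>1 \<epsilon>3 A \<phi> x" and nonneg: "0 \<le> \<epsilon>1" "0 \<le> \<epsilon>3" "0 \<le> \<sigma> t"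
    and b: "bounding_functions K \<phi> \<sigma> \<rho> \<delta> Ups Ups2" "0 < \<delta>" and l: "l \<le> K"
  shows "0 \<le> residual K \<epsilon>1 \<epsilon>3 A \<sigma> Ups2 l t"
  unfolding residual_def sum_amp_def
  using signal_representation_modeD(1)[OF x nonneg(2)] bounding_functions_pos[OF b l] Pi_err_nonneg[where \<sigma> = \<sigma>, OF nonneg]
  by (intro add_nonneg_nonneg mult_nonneg_nonneg sum_nonneg) (auto intro: less_imp_le)

text \<open>
  The sum in the residual lacks the mode \<open>l\<close>, so bounding every \<open>Ups2\<close> by \<open>Ups\<close> leaves
  \<open>A l t * Ups t\<close> to spare. Strictness is needed because the super-level set is defined by a strict
  inequality, and it requires \<open>Ups t > 0\<close>, which is read off from any second mode.
\<close>

lemma residual_less: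
  assumes x: "signal_representation K \<epsilon>1 \<epsilon>3 A \<phi> x" and \<epsilon>3: "0 \<le> \<epsilon>3" and K: "1 \<le> K"
    and b: "bounding_functions K \<phi> \<sigma> \<rho> \<delta> Ups Ups2" "0 < \<delta>" and l: "l \<le> K"
  shows "residual K \<epsilon>1 \<epsilon>3 A \<sigma> Ups2 l t < sum_amp K A t * (Ups t + Pi_err \<epsilon>1 \<epsilon>3 \<sigma> t)"
proof -
  have A: "0 < A k t" if "k \<le> K" for k
    by (rule signal_representation_modeD(1)[OF x \<epsilon>3 that])
  have U: "Ups2 l k t \<le> Ups t" if "k \<le> K" "k \<noteq> l" for k
    using b l that by (simp add: bounding_functions_def)
  obtain k where k: "k \<le> K" "k \<noteq> l"
    using K by (cases "l = 0") (auto intro: that[of 0] that[of 1])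
  have Ups: "0 < Ups t"
    using bounding_functions_pos[OF b l k] U[OF k] less_le_trans by blast
  have "(\<Sum>k\<in>{..K} - {l}. A k t * Ups2 l k t) \<le> (\<Sum>k\<in>{..K} - {l}. A k t * Ups t)"
    using U A by (intro sum_mono mult_left_mono) (auto intro: less_imp_le)
  also have "\<dots> < (\<Sum>k\<in>{..K} - {l}. A k t * Ups t) + A l t * Ups t"
    using A[OF l] Ups by simp
  also have "\<dots> = sum_amp K A t * Ups t"
    unfolding sum_amp_def sum_distrib_right using l by (subst (2) sum.remove[of _ l]) auto
  finally show ?thesis
    by (simp add: residual_def distrib_left)
qed

lemma chirplet_transform_in_zone:
  assumes x: "signal_representation K \<epsilon>1 \<epsilon>3 A \<phi> x" and \<epsilon>3: "0 \<le> \<epsilon>3" and \<sigma>: "\<sigma> t > 0"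
    and b: "bounding_functions K \<phi> \<sigma> \<rho> \<delta> Ups Ups2" and l: "l \<le> K"
    and z: "(t, \<eta>, lam) \<in> zone \<phi> \<rho> \<delta> l"
  shows "cmod (chirplet_transform \<sigma> x t \<eta> lam
      - mode A \<phi> l t * window_transform (\<sigma> t * (\<eta> - deriv (\<phi> l) t))
                                          ((\<sigma> t)\<^sup>2 * (lam - (deriv ^^ 2) (\<phi> l) t)))
    \<le> residual K \<epsilon>1 \<epsilon>3 A \<sigma> Ups2 l t"
proof -
  let ?W = "\<lambda>k. window_transform (\<sigma> t * (\<eta> - deriv (\<phi> k) t)) ((\<sigma> t)\<^sup>2 * (lam - (deriv ^^ 2) (\<phi> k) t))"
  let ?Q = "chirplet_transform \<sigma> x t \<eta> lam"
  have A: "0 < A k t" if "k \<le> K" for k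
    by (rule signal_representation_modeD(1)[OF x \<epsilon>3 that])
  have "?Q - mode A \<phi> l t * ?W l
      = (?Q - (\<Sum>k\<le>K. mode A \<phi> k t * ?W k)) + (\<Sum>k\<in>{..K} - {l}. mode A \<phi> k t * ?W k)"
    using l by (simp add: sum.remove[of "{..K}" l])
  then have "cmod (?Q - mode A \<phi> l t * ?W l)
      \<le> cmod (?Q - (\<Sum>k\<le>K. mode A \<phi> k t * ?W k)) + cmod (\<Sum>k\<in>{..K} - {l}. mode A \<phi> k t * ?W k)"
    by (simp only: norm_triangle_ineq)
  moreover have "cmod (?Q - (\<Sum>k\<le>K. mode A \<phi> k t * ?W k)) \<le> sum_amp K A t * Pi_err \<epsilon>1 \<epsilon>3 \<sigma> t"
    by (rule chirplet_transform_signal_bound[where \<sigma> = \<sigma>, OF x \<epsilon>3 \<sigma>])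
  moreover have "cmod (\<Sum>k\<in>{..K} - {l}. mode A \<phi> k t * ?W k) \<le> (\<Sum>k\<in>{..K} - {l}. A k t * Ups2 l k t)"
  proof (rule sum_norm_le)
    fix k assume k: "k \<in> {..K} - {l}"
    then have "cmod (?W k) \<le> Ups2 l k t"
      using b l z unfolding bounding_functions_def by auto
    then show "cmod (mode A \<phi> k t * ?W k) \<le> A k t * Ups2 l k t"
      using A[of k] k by (simp add: norm_mult norm_mode mult_left_mono)
  qed
  ultimately show ?thesis
    by (simp add: residual_def)
qed

section \<open>Recovery of frequencies, chirp rates and modes\<close>

text \<open>
  From \<open>- ln q \<le> 1 / q - 1\<close> and \<open>1 / q \<le> exp (1 / 4)\<close> one gets
  \<open>- ln q \<le> exp (1 / 4) * 2 * r / a\<close>. The square root of \<open>exp (1 / 4)\<close> is the constant \<open>exp (1 / 8)\<close> of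
  the reconstruction error.
\<close>

lemma sqrt_neg_ln_bound:
  assumes a: "0 < a" and r: "0 \<le> r" and q: "exp (- 1 / 4) \<le> 1 - 2 * r / a"
  shows "sqrt 2 * a * sqrt (- ln (1 - 2 * r / a)) \<le> 2 * exp (1 / 8) * sqrt (r * a)"
proof -
  define q where "q = 1 - 2 * r / a"
  have q0: "0 < q"
    using assms(3) exp_gt_zero less_le_trans unfolding q_def by blast
  have "1 / q \<le> 1 / exp (- 1 / 4)"
    using q unfolding q_def[symmetric] by (intro divide_left_mono) (use q0 in auto)
  then have inv: "1 / q \<le> exp (1 / 4)"
    by (simp add: exp_minus field_simps)
  have "- ln q \<le> 1 / q - 1"
    using ln_le_minus_one[of "1 / q"] q0 by (simp add: ln_div)
  also have "\<dots> = (2 * r / a) * (1 / q)"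
    using q0 by (simp add: field_simps) (use a in \<open>simp add: q_def field_simps\<close>)
  also have "\<dots> \<le> (2 * r / a) * exp (1 / 4)"
    using inv r a by (intro mult_left_mono) auto
  finally have "2 * a\<^sup>2 * (- ln q) \<le> 2 * a\<^sup>2 * ((2 * r / a) * exp (1 / 4))"
    by (intro mult_left_mono) auto
  also have "\<dots> = (2 * exp (1 / 8) * sqrt (r * a))\<^sup>2"
  proof -
    have "(exp (1 / 8))\<^sup>2 = exp (1 / 4 :: real)"
      by (simp flip: exp_double)
    moreover have "2 * a\<^sup>2 * ((2 * r / a) * exp (1 / 4)) = 4 * (r * a) * exp (1 / 4)"
      using a by (simp add: power2_eq_square)
    ultimately show ?thesis
      using a r by (simp add: power_mult_distrib)
  qed
  finally have "sqrt (2 * a\<^sup>2 * (- ln q)) \<le> 2 * exp (1 / 8) * sqrt (r * a)"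
    using a r by (intro real_le_lsqrt) auto
  moreover have "sqrt (2 * a\<^sup>2 * (- ln q)) = sqrt 2 * a * sqrt (- ln q)"
    using a by (simp only: real_sqrt_mult real_sqrt_abs abs_of_pos)
  ultimately show ?thesis
    unfolding q_def by simp
qed

theorem theorem3:
  fixes K :: nat
    and \<epsilon>1 \<epsilon>3 \<rho> \<delta> t \<epsilon>t :: real
    and A \<phi> :: "nat \<Rightarrow> real \<Rightarrow> real"
    and x :: "real \<Rightarrow> complex"
    and \<sigma> Ups :: "real \<Rightarrow> real"
    and Ups2 :: "nat \<Rightarrow> nat \<Rightarrow> real \<Rightarrow> real"
    and \<eta>h lamh :: "nat \<Rightarrow> real"
  defines "M \<equiv> sum_amp K A t"
    and "\<mu> \<equiv> min_amp K A t"
    and "P \<equiv> Pi_err \<epsilon>1 \<epsilon>3 \<sigma> t"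
    and "Res \<equiv> (\<lambda>l. residual K \<epsilon>1 \<epsilon>3 A \<sigma> Ups2 l t)"
  assumes "K \<ge> 1"
    and "\<epsilon>1 > 0" and "\<epsilon>3 > 0"
    and "signal_representation K \<epsilon>1 \<epsilon>3 A \<phi> x"
    and "\<And>s. \<sigma> s > 0"
    and "\<rho> > 0" and "\<delta> > 0"
    and "\<And>s k l. k \<le> K \<Longrightarrow> l \<le> K \<Longrightarrow> k \<noteq> l \<Longrightarrow>
           \<bar>deriv (\<phi> k) s - deriv (\<phi> l) s\<bar>
             + \<rho> * \<bar>(deriv ^^ 2) (\<phi> k) s - (deriv ^^ 2) (\<phi> l) s\<bar> \<ge> 2 * \<delta>"
    and "bounding_functions K \<phi> \<sigma> \<rho> \<delta> Ups Ups2"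
    and "2 * M * (Ups t + P) \<le> \<mu>"
    and "\<And>l. l \<le> K \<Longrightarrow> 2 * Res l / A l t \<le> 1 - exp (- 1 / 4)"
    and "\<epsilon>t > 0"
    and "M * (Ups t + P) \<le> \<epsilon>t"
    and "\<epsilon>t \<le> \<mu> - M * (Ups t + P)"
    and "\<eta>h 0 = 0" and "lamh 0 = 0"
    and "\<And>k. 1 \<le> k \<Longrightarrow> k \<le> K \<Longrightarrow>
           is_arg_max (\<lambda>(\<eta>, lam). cmod (chirplet_transform \<sigma> x t \<eta> lam))
             (\<lambda>p. p \<in> super_level_component \<sigma> x \<epsilon>t \<phi> \<rho> \<delta> t k) (\<eta>h k, lamh k)"
  shows "(\<forall>l\<in>{1..K}.
            \<bar>\<eta>h l - deriv (\<phi> l) t\<bar>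
              \<le> 1 / (\<sigma> t * pi * sqrt 2) * sqrt (- ln (1 - 2 * Res l / A l t)) \<and>
            \<bar>lamh l - (deriv ^^ 2) (\<phi> l) t\<bar>
              \<le> 1 / ((\<sigma> t)\<^sup>2 * 2 * pi * (1 - 2 * Res l / A l t)\<^sup>2)
                  * sqrt (1 - (1 - 2 * Res l / A l t) ^ 4)) \<and>
         (\<forall>l\<in>{0..K}.
            cmod (chirplet_transform \<sigma> x t (\<eta>h l) (lamh l) - mode A \<phi> l t)
              \<le> Res l + 2 * exp (1 / 8) * window_moment 1 * sqrt (Res l * A l t)
                 + window_moment 2 * A l t / (2 * (1 - 2 * Res l / A l t)\<^sup>2)
                     * sqrt (1 - (1 - 2 * Res l / A l t) ^ 4))"
proof -
  have K: "1 \<le> K" and \<epsilon>: "0 \<le> \<epsilon>1" "0 \<le> \<epsilon>3" and \<sigma>: "\<sigma> t > 0" "0 \<le> \<sigma> t"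
    and x: "signal_representation K \<epsilon>1 \<epsilon>3 A \<phi> x" and \<delta>: "0 < \<delta>"
    and b: "bounding_functions K \<phi> \<sigma> \<rho> \<delta> Ups Ups2"
    using assms less_imp_le by blast+
  let ?Q = "chirplet_transform \<sigma> x t"
  let ?a = "\<lambda>l. deriv (\<phi> l) t" and ?b = "\<lambda>l. (deriv ^^ 2) (\<phi> l) t"
  let ?u = "\<lambda>l. \<sigma> t * (\<eta>h l - ?a l)" and ?v = "\<lambda>l. (\<sigma> t)\<^sup>2 * (lamh l - ?b l)"
  define q where "q l = 1 - 2 * Res l / A l t" for l
  have A: "0 < A l t" if "l \<le> K" for l
    by (rule signal_representation_modeD(1)[OF x \<epsilon>(2) that])
  have Res0: "0 \<le> Res l" if "l \<le> K" for l
    unfolding Res_def by (rule residual_nonneg[where \<sigma> = \<sigma>, OF x \<epsilon> \<sigma>(2) b \<delta> that])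
  have q: "exp (- 1 / 4) \<le> q l" "0 < q l" "q l \<le> 1" if "l \<le> K" for l
  proof -
    show *: "exp (- 1 / 4) \<le> q l"
      using assms(15)[OF that] by (simp add: q_def)
    show "0 < q l"
      using * exp_gt_zero less_le_trans by blast
    show "q l \<le> 1"
      using Res0[OF that] A[OF that] by (simp add: q_def)
  qed
  have approx: "cmod (?Q \<eta> lam - mode A \<phi> l t * window_transform (\<sigma> t * (\<eta> - ?a l)) ((\<sigma> t)\<^sup>2 * (lam - ?b l)))
      \<le> Res l" if "l \<le> K" "(t, \<eta>, lam) \<in> zone \<phi> \<rho> \<delta> l" for l \<eta> lam
    unfolding Res_def by (rule chirplet_transform_in_zone[where \<sigma> = \<sigma>, OF x \<epsilon>(2) \<sigma>(1) b that])
  have estimates: "(t, \<eta>h l, lamh l) \<in> zone \<phi> \<rho> \<delta> l \<and> q l \<le> cmod (window_transform (?u l) (?v l))"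
    if l: "l \<in> {1..K}" for l
  proof -
    have lK: "l \<le> K" using l by simp
    \<comment> \<open>At the centre of the zone the window transform attains its maximal modulus \<open>1\<close>.\<close>
    have peak: "A l t - Res l \<le> cmod (?Q (?a l) (?b l))"
    proof -
      have "cmod (?Q (?a l) (?b l) - mode A \<phi> l t) \<le> Res l"
        using approx[OF lK center_in_zone[OF \<delta>]] by simp
      moreover have "cmod (mode A \<phi> l t) = A l t"
        by (rule norm_mode[where A = A and k = l, OF A[OF lK]])
      ultimately show ?thesis
        using norm_triangle_ineq2[of "mode A \<phi> l t" "?Q (?a l) (?b l)"] by (simp add: norm_minus_commute)
    qed
    have "\<mu> \<le> A l t"
      unfolding \<mu>_def min_amp_def using lK by (intro Min_le) auto
    moreover have "Res l < M * (Ups t + P)"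
      unfolding Res_def M_def P_def by (rule residual_less[OF x \<epsilon>(2) K b \<delta> lK])
    ultimately have "\<epsilon>t < cmod (?Q (?a l) (?b l))"
      using peak assms(18) by linarith
    then have center: "(?a l, ?b l) \<in> super_level_component \<sigma> x \<epsilon>t \<phi> \<rho> \<delta> t l"
      using \<delta> by (simp add: super_level_component_def super_level_def)
    have max: "is_arg_max (\<lambda>(\<eta>, lam). cmod (?Q \<eta> lam))
        (\<lambda>p. p \<in> super_level_component \<sigma> x \<epsilon>t \<phi> \<rho> \<delta> t l) (\<eta>h l, lamh l)"
      using assms(21)[of l] l by simp
    have z: "(t, \<eta>h l, lamh l) \<in> zone \<phi> \<rho> \<delta> l"
      using max by (simp add: is_arg_max_def super_level_component_def zone_def)
    have "cmod (?Q (?a l) (?b l)) \<le> cmod (?Q (\<eta>h l) (lamh l))"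
      using max center unfolding is_arg_max_linorder by fastforce
    also have "\<dots> \<le> cmod (mode A \<phi> l t * window_transform (?u l) (?v l)) + Res l"
      using approx[OF lK z]
        norm_triangle_ineq2[of "?Q (\<eta>h l) (lamh l)" "mode A \<phi> l t * window_transform (?u l) (?v l)"]
      by linarith
    also have "cmod (mode A \<phi> l t * window_transform (?u l) (?v l)) = A l t * cmod (window_transform (?u l) (?v l))"
      using norm_mode[where A = A and k = l, OF A[OF lK]] by (simp add: norm_mult)
    finally have "A l t - 2 * Res l \<le> A l t * cmod (window_transform (?u l) (?v l))"
      using peak by linarith
    then have "q l \<le> cmod (window_transform (?u l) (?v l))"
      using A[OF lK] by (simp add: q_def field_simps)
    with z show ?thesis by blast
  qed
  have u: "\<bar>?u l\<bar> \<le> 1 / (pi * sqrt 2) * sqrt (- ln (q l))"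
    and v: "\<bar>?v l\<bar> \<le> 1 / (2 * pi * (q l)\<^sup>2) * sqrt (1 - q l ^ 4)" if "l \<in> {1..K}" for l
    using frequency_le_of_window_transform_ge[of "q l" "?u l" "?v l"]
      chirp_rate_le_of_window_transform_ge[of "q l" "?u l" "?v l"] estimates[OF that] q[of l] that
    by auto
  have center0: "?a 0 = 0" "?b 0 = 0"
    using x by (simp_all add: signal_representation_def eval_nat_numeral)
  \<comment> \<open>The estimates of the trend are its exact parameters, so both offsets vanish and the bounds hold trivially.\<close>
  have all: "(t, \<eta>h l, lamh l) \<in> zone \<phi> \<rho> \<delta> l \<and>
      \<bar>?u l\<bar> \<le> 1 / (pi * sqrt 2) * sqrt (- ln (q l)) \<and>
      \<bar>?v l\<bar> \<le> 1 / (2 * pi * (q l)\<^sup>2) * sqrt (1 - q l ^ 4)" if l: "l \<le> K" for l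
  proof (cases "l = 0")
    case True
    have "q 0 ^ 4 \<le> 1" "ln (q 0) \<le> 0"
      using q[of 0] by (auto intro: power_le_one)
    then show ?thesis
      using True center0 \<delta> assms(19,20) by (simp add: zone_def)
  next
    case False
    then show ?thesis
      using estimates[of l] u[of l] v[of l] l by simp
  qed
  show ?thesis
  proof (intro conjI ballI)
    fix l assume l: "l \<in> {1..K}"
    have "1 / (\<sigma> t * pi * sqrt 2) * sqrt (- ln (q l)) = 1 / (pi * sqrt 2) * sqrt (- ln (q l)) / \<sigma> t"
      by simp
    also have "\<bar>\<eta>h l - ?a l\<bar> \<le> \<dots>"
      using u[OF l] \<sigma>(1) by (simp only: pos_le_divide_eq abs_mult abs_of_pos mult_ac)
    finally show "\<bar>\<eta>h l - ?a l\<bar> \<le> 1 / (\<sigma> t * pi * sqrt 2) * sqrt (- ln (1 - 2 * Res l / A l t))"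
      unfolding q_def .
    have "1 / ((\<sigma> t)\<^sup>2 * 2 * pi * (q l)\<^sup>2) * sqrt (1 - q l ^ 4)
        = 1 / (2 * pi * (q l)\<^sup>2) * sqrt (1 - q l ^ 4) / (\<sigma> t)\<^sup>2"
      by simp
    also have "\<bar>lamh l - ?b l\<bar> \<le> \<dots>"
      using v[OF l] \<sigma>(1) by (simp only: pos_le_divide_eq zero_less_power abs_mult abs_power2 mult_ac)
    finally show "\<bar>lamh l - ?b l\<bar>
        \<le> 1 / ((\<sigma> t)\<^sup>2 * 2 * pi * (1 - 2 * Res l / A l t)\<^sup>2) * sqrt (1 - (1 - 2 * Res l / A l t) ^ 4)"
      unfolding q_def .
  next
    fix l assume "l \<in> {0..K}"
    then have l: "l \<le> K" by simp
    let ?W = "window_transform (?u l) (?v l)"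
    have mode: "cmod (mode A \<phi> l t) = A l t"
      by (rule norm_mode[where A = A and k = l, OF A[OF l]])
    have "?Q (\<eta>h l) (lamh l) - mode A \<phi> l t = (?Q (\<eta>h l) (lamh l) - mode A \<phi> l t * ?W) + mode A \<phi> l t * (?W - 1)"
      by (simp add: algebra_simps)
    then have "cmod (?Q (\<eta>h l) (lamh l) - mode A \<phi> l t)
        \<le> cmod (?Q (\<eta>h l) (lamh l) - mode A \<phi> l t * ?W) + A l t * cmod (?W - 1)"
      by (metis norm_triangle_ineq norm_mult mode)
    also have "\<dots> \<le> Res l + A l t * (2 * pi * \<bar>?u l\<bar> * window_moment 1 + pi * \<bar>?v l\<bar> * window_moment 2)"
      using A[OF l] all[OF l] by (intro add_mono approx l mult_left_mono window_transform_near_one) auto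
    also have "\<dots> \<le> Res l + A l t *
        (2 * pi * (1 / (pi * sqrt 2) * sqrt (- ln (q l))) * window_moment 1
          + pi * (1 / (2 * pi * (q l)\<^sup>2) * sqrt (1 - q l ^ 4)) * window_moment 2)"
      using A[OF l] all[OF l]
      by (intro add_left_mono mult_left_mono add_mono mult_right_mono) (auto simp: window_moment_nonneg)
    also have "\<dots> = Res l + (sqrt 2 * A l t * sqrt (- ln (q l))) * window_moment 1
        + window_moment 2 * A l t / (2 * (q l)\<^sup>2) * sqrt (1 - q l ^ 4)"
      using real_div_sqrt[of 2] by (simp add: field_simps)
    also have "\<dots> \<le> Res l + (2 * exp (1 / 8) * sqrt (Res l * A l t)) * window_moment 1
        + window_moment 2 * A l t / (2 * (q l)\<^sup>2) * sqrt (1 - q l ^ 4)"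
      using sqrt_neg_ln_bound[OF A[OF l] Res0[OF l]] q(1)[OF l] unfolding q_def
      by (intro add_right_mono add_left_mono mult_right_mono window_moment_nonneg) auto
    also have "\<dots> = Res l + 2 * exp (1 / 8) * window_moment 1 * sqrt (Res l * A l t)
        + window_moment 2 * A l t / (2 * (q l)\<^sup>2) * sqrt (1 - q l ^ 4)"
      by simp
    finally show "cmod (?Q (\<eta>h l) (lamh l) - mode A \<phi> l t)
        \<le> Res l + 2 * exp (1 / 8) * window_moment 1 * sqrt (Res l * A l t)
          + window_moment 2 * A l t / (2 * (1 - 2 * Res l / A l t)\<^sup>2)
              * sqrt (1 - (1 - 2 * Res l / A l t) ^ 4)"
      unfolding q_def .
  qed
qed

end
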